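(* For $i \geqslant 0$, let $a \in A$ satisfy $\deg a \leqslant i$. The following identities hold in $\mathbb{F}_q(\theta,t)$. (a) For $0 \leqslant j \leqslant i$, $$ \partial_{\theta}^j(a) = \sum_{\ell=0}^{i} \kappa_{ij\ell}\bigl( t-\theta,\, t^q-\theta,\, \dots,\, t^{q^i} - \theta \bigr)\, a(t)^{q^{\ell}}. $$ (b) More generally, for $0 \leqslant j \leqslant i$ and $k \geqslant 0$, $$ \partial_{\theta}^j(a)^{q^k} = \sum_{\ell=0}^{i} \kappa_{ij\ell}\bigl( t-\theta^{q^k},\, t^q-\theta^{q^k},\, \dots,\, t^{q^i} - \theta^{q^k} \bigr)\, a(t)^{q^{\ell}}. $$
   Context: Let $q$ be a power of a prime, $A = \mathbb{F}_q[\theta]$, and let $t$ be a variable independent of $\theta$. For $a \in A$, $a(t) \in \mathbb{F}_q[t]$ denotes the polynomial obtained from $a$ by replacing $\theta$ by $t$. For $j \geqslant 0$, the hyperderivative $\partial_\theta^j : A \to A$ is the $\mathbb{F}_q$-linear map with $\partial_\theta^j(\theta^n) = \binom{n}{j}\theta^{n-j}$ (which is $0$ when $n<j$). For variables $x_0,\dots,x_i$, let $V_i(x_0,\dots,x_i)$ be the $(i+1)\times(i+1)$ Vandermonde matrix whose row indexed by $r$ ($0\leqslant r\leqslant i$) is $(1, x_r, x_r^2,\dots,x_r^i)$, and let $\kappa_{ij\ell}(x_0,\dots,x_i)$ ($0\leqslant j,\ell\leqslant i$) be the entry of $V_i(x_0,\dots,x_i)^{-1}$ in row $j$ and column $\ell$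 (rows and columns indexed from $0$). Explicitly, $$\kappa_{ij\ell}(x_0,\dots,x_i) = \frac{(-1)^{i-j}e_{i,i-j}(x_0,\dots,\widehat{x_\ell},\dots,x_i)}{\prod_{m\neq \ell}(x_\ell-x_m)},$$ where $\widehat{x_\ell}$ means $x_\ell$ is omitted and $e_{i,j}$ is the elementary symmetric polynomial of degree $j$ in $i$ variables. *)

theory Defs
  imports
    "Jordan_Normal_Form.Gauss_Jordan_Elimination"
    "Jordan_Normal_Form.Determinant"
    "HOL-Computational_Algebra.Normalized_Fraction"
    "HOL-Library.Cardinality"
begin

text \<open>
  The finite field \<open>\<F>\<^sub>q\<close> is a type \<open>'a\<close> of sort \<open>{field, finite}\<close> with \<open>q = CARD('a)\<close>, the ring
  \<open>A = \<F>\<^sub>q[\<theta>]\<close> is \<open>'a poly\<close>, and \<open>\<F>\<^sub>q(\<theta>, t)\<close> is the fraction field of \<open>\<F>\<^sub>q[\<theta>][t]\<close>. Thus the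
  outer polynomial variable is \<open>t\<close> and the inner one is \<open>\<theta>\<close>.
\<close>

type_synonym 'a ratfun2 = "'a poly poly fract"

definition theta :: "'a::field ratfun2" where
  "theta = to_fract [:[:0, 1:]:]"

definition tvar :: "'a::field ratfun2" where
  "tvar = to_fract [:0, 1:]"

text \<open>The inclusion of \<open>A\<close> into \<open>\<F>\<^sub>q(\<theta>, t)\<close>.\<close>

definition in_theta :: "'a::field poly \<Rightarrow> 'a ratfun2" where
  "in_theta a = to_fract [:a:]"

text \<open>The element \<open>a(t)\<close>, obtained from \<open>a\<close> by replacing \<open>\<theta>\<close> by \<open>t\<close>.\<close>

definition in_t :: "'a::field poly \<Rightarrow> 'a ratfun2" where
  "in_t a = to_fract (map_poly (\<lambda>c. [:c:]) a)"

text \<open>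
  The linear extension of \<open>\<theta>\<^sup>n \<mapsto> (n choose j) \<theta>\<^bsup>n-j\<^esup>\<close>. For \<open>n < j\<close> the subtraction is truncated,
  but then the binomial coefficient vanishes.
\<close>

definition hyperderiv :: "nat \<Rightarrow> 'a::field poly \<Rightarrow> 'a poly" where
  "hyperderiv j a = (\<Sum>n\<le>degree a. monom (coeff a n * of_nat (n choose j)) (n - j))"

lemma coeff_hyperderiv:
  "coeff (hyperderiv j a) m = of_nat ((m + j) choose j) * coeff a (m + j)"
proof -
  have "coeff (hyperderiv j a) m =
      (\<Sum>n\<le>degree a. if n = m + j then coeff a n * of_nat (n choose j) else 0)"
    unfolding hyperderiv_def coeff_sum
    by (intro sum.cong refl) (auto simp: binomial_eq_0 coeff_monom)
  also have "\<dots> = of_nat ((m + j) choose j) * coeff a (m + j)"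
    by (auto simp: sum.delta coeff_eq_0 not_le)
  finally show ?thesis .
qed

lemma hyperderiv_add: "hyperderiv j (a + b) = hyperderiv j a + hyperderiv j b"
  by (intro poly_eqI) (simp add: coeff_hyperderiv algebra_simps)

lemma hyperderiv_smult: "hyperderiv j (smult c a) = smult c (hyperderiv j a)"
  by (intro poly_eqI) (simp add: coeff_hyperderiv algebra_simps)

lemma hyperderiv_monom:
  "hyperderiv j (monom 1 n) = smult (of_nat (n choose j)) (monom 1 (n - j))"
  by (intro poly_eqI) (auto simp: coeff_hyperderiv coeff_monom binomial_eq_0)

definition vandermonde :: "nat \<Rightarrow> (nat \<Rightarrow> 'b::field) \<Rightarrow> 'b mat" where
  "vandermonde i x = mat (Suc i) (Suc i) (\<lambda>(r, c). x r ^ c)"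

text \<open>
  \<open>kappa i j l x\<close> is the entry in row \<open>j\<close> and column \<open>l\<close> of the inverse Vandermonde matrix at the
  values \<open>x 0, \<dots>, x i\<close>; it is meaningful only if these are pairwise distinct.
\<close>

definition kappa :: "nat \<Rightarrow> nat \<Rightarrow> nat \<Rightarrow> (nat \<Rightarrow> 'b::field) \<Rightarrow> 'b" where
  "kappa i j l x = the (mat_inverse (vandermonde i x)) $$ (j, l)"

lemma mat_inverse_vandermonde:
  fixes x :: "nat \<Rightarrow> 'b::field"
  assumes "inj_on x {..i}"
  obtains B where "mat_inverse (vandermonde i x) = Some B"
    "B \<in> carrier_mat (Suc i) (Suc i)"
    "vandermonde i x * B = 1\<^sub>m (Suc i)" "B * vandermonde i x = 1\<^sub>m (Suc i)"
proof -
  let ?V = "vandermonde i x"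
  have V: "?V \<in> carrier_mat (Suc i) (Suc i)"
    by (simp add: vandermonde_def)
  have "det ?V \<noteq> 0"
  proof
    assume "det ?V = 0"
    then obtain v where v: "v \<in> carrier_vec (Suc i)" "v \<noteq> 0\<^sub>v (Suc i)" "?V *\<^sub>v v = 0\<^sub>v (Suc i)"
      using det_0_iff_vec_prod_zero_field[OF V] by auto
    define p where "p = (\<Sum>c\<le>i. monom (v $ c) c)"
    have coeff_p: "coeff p c = v $ c" if "c \<le> i" for c
      using that by (simp add: p_def coeff_sum coeff_monom)
    have "degree p \<le> i"
      unfolding p_def by (intro degree_sum_le) (auto intro: order_trans[OF degree_monom_le])
    have root: "poly p (x r) = 0" if "r \<le> i" for r
    proof -
      have "(?V *\<^sub>v v) $ r = (\<Sum>c = 0..<Suc i. x r ^ c * v $ c)"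
        using that v(1) by (simp add: vandermonde_def scalar_prod_def)
      also have "\<dots> = poly p (x r)"
        by (simp add: p_def poly_sum poly_monom mult.commute lessThan_Suc_atMost
            atLeast0LessThan)
      finally show ?thesis using v(3) that by simp
    qed
    have "p = 0"
    proof (rule ccontr)
      assume "p \<noteq> 0"
      have "Suc i = card (x ` {..i})"
        using assms by (simp add: card_image)
      also have "\<dots> \<le> card {z. poly p z = 0}"
        using root by (intro card_mono poly_roots_finite \<open>p \<noteq> 0\<close>) auto
      also have "\<dots> \<le> degree p"
        by (rule card_poly_roots_bound) fact
      finally show False using \<open>degree p \<le> i\<close> by simp
    qed
    then have "v = 0\<^sub>v (Suc i)"
      using v(1) coeff_p by (intro eq_vecI) (auto simp: less_Suc_eq_le)
    with v(2) show False ..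
  qed
  then have "?V \<in> Units (ring_mat TYPE('b) (Suc i) ())"
    by (rule det_non_zero_imp_unit[OF V])
  then obtain B where B: "mat_inverse ?V = Some B"
    using mat_inverse(1)[OF V, of "()"] by (cases "mat_inverse ?V") auto
  from mat_inverse(2)[OF V B] B show ?thesis using that by blast
qed

end

theory Submission
  imports Defs "Jordan_Normal_Form.Char_Poly"
begin

text \<open>
  The identity is Taylor's formula read backwards. For \<open>x\<close> and \<open>y\<close> in a commutative ring over
  \<open>\<F>\<^sub>q\<close> and \<open>deg a \<le> i\<close>, the hyperderivatives are the coefficients in
  \<open>a(x) = (\<Sum>n\<le>i. (\<partial>\<^sup>n a)(y) \<cdot> (x - y)\<^sup>n)\<close>. Take \<open>x = t\<^bsup>q^l\<^esup>\<close> for \<open>l = 0, \<dots>, i\<close> and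
  \<open>y = \<theta>\<^bsup>q^k\<^esup>\<close>. The coefficients of \<open>a\<close> and of \<open>\<partial>\<^sup>n a\<close> are fixed by the \<open>q\<close>-power Frobenius, so
  \<open>a(t\<^bsup>q^l\<^esup>) = a(t)\<^bsup>q^l\<^esup>\<close> and \<open>(\<partial>\<^sup>n a)(\<theta>\<^bsup>q^k\<^esup>) = (\<partial>\<^sup>n a)\<^bsup>q^k\<^esup>\<close>. The resulting \<open>i + 1\<close>
  equations (\<open>taylor_hyperderiv\<close> combined with \<open>poly_map_poly_power_card_power\<close>) form a linear
  system for the vector of the \<open>(\<partial>\<^sup>n a)\<^bsup>q^k\<^esup>\<close>, whose matrix is the Vandermonde matrix at the nodes
  \<open>t\<^bsup>q^l\<^esup> - \<theta>\<^bsup>q^k\<^esup>\<close>. These are pairwise distinct, so the matrix may be inverted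
  (\<open>kappa_solves_vandermonde\<close>). The first identity is the case \<open>k = 0\<close> of the second.
\<close>

section \<open>The \<open>q\<close>-power Frobenius\<close>

text \<open>
  Multiplication by a nonzero \<open>x\<close> permutes the nonzero elements, so it does not change their
  product; cancelling the product leaves \<open>x\<^bsup>q-1\<^esup> = 1\<close>.
\<close>

lemma power_card_finite_field:
  fixes x :: "'a::{field, finite}"
  shows "x ^ CARD('a) = x"
proof (cases "x = 0")
  case True
  then show ?thesis by simp
next
  case False
  let ?U = "UNIV - {0::'a}"
  have "bij_betw ((*) x) ?U ?U"
    by (rule bij_betw_byWitness[where f' = "\<lambda>y. y / x"]) (use False in auto)
  then have "\<Prod>?U = (\<Prod>y\<in>?U. x * y)"
    by (rule prod.reindex_bij_betw[symmetric])
  also have "\<dots> = x ^ card ?U * \<Prod>?U"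
    by (simp add: prod.distrib)
  finally have "x ^ card ?U = 1"
    by simp
  moreover have "CARD('a) = Suc (card ?U)"
    by (rule card.remove) simp_all
  ultimately show ?thesis
    by (simp only: power_Suc mult_1_right)
qed

text \<open>
  The polynomial \<open>(X + 1)\<^sup>q - X\<^sup>q - 1\<close> has degree less than \<open>q\<close> but vanishes at all \<open>q\<close> elements of
  the field, so all its coefficients are zero.
\<close>

lemma of_nat_card_choose_eq_0:
  assumes "0 < k" "k < CARD('a)"
  shows "of_nat (CARD('a) choose k) = (0::'a::{field, finite})"
proof -
  let ?q = "CARD('a)"
  define p :: "'a poly" where "p = (\<Sum>n\<in>{0<..<?q}. monom (of_nat (?q choose n)) n)"
  have coeff_p: "coeff p k = of_nat (?q choose k)"
    using assms by (simp add: p_def coeff_sum coeff_monom)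
  have "degree p \<le> ?q - 1"
    unfolding p_def by (intro degree_sum_le) (auto intro: order_trans[OF degree_monom_le])
  then have deg: "degree p < ?q"
    using assms by linarith
  have root: "poly p c = 0" for c
  proof -
    have "{..?q} = insert 0 (insert ?q {0<..<?q})"
      by auto
    then have "(c + 1) ^ ?q = 1 + c ^ ?q + poly p c"
      using assms by (simp add: binomial_ring p_def poly_sum poly_monom add.assoc)
    then show ?thesis
      by (simp add: power_card_finite_field)
  qed
  have "p = 0"
  proof (rule ccontr)
    assume "p \<noteq> 0"
    then have "card {c. poly p c = 0} \<le> degree p"
      by (rule card_poly_roots_bound)
    with root deg show False
      by simp
  qed
  with coeff_p show ?thesis
    by simp
qed

lemma power_card_add:
  fixes h :: "'a::{field, finite} \<Rightarrow> 'b::comm_ring_1"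
    and x y :: 'b
  assumes "comm_ring_hom h"
  shows "(x + y) ^ CARD('a) = x ^ CARD('a) + y ^ CARD('a)"
proof -
  interpret comm_ring_hom h by fact
  let ?q = "CARD('a)"
  have choose: "of_nat (?q choose k) = (0::'b)" if "0 < k" "k < ?q" for k
    using arg_cong[OF of_nat_card_choose_eq_0[OF that], of h] by (simp only: hom_of_nat hom_zero)
  have "(x + y) ^ ?q = (\<Sum>k\<le>?q. of_nat (?q choose k) * x ^ k * y ^ (?q - k))"
    by (rule binomial_ring)
  also have "\<dots> = (\<Sum>k\<in>{0, ?q}. of_nat (?q choose k) * x ^ k * y ^ (?q - k))"
    by (intro sum.mono_neutral_right) (auto simp: choose)
  finally show ?thesis
    by (simp add: add.commute)
qed

text \<open>
  The \<open>q\<close>-power map is a ring endomorphism fixing the coefficients, so it passes from the value of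
  a polynomial to the argument.
\<close>

lemma poly_map_poly_power_card:
  fixes h :: "'a::{field, finite} \<Rightarrow> 'b::comm_ring_1"
  assumes "comm_ring_hom h"
  shows "poly (map_poly h a) x ^ CARD('a) = poly (map_poly h a) (x ^ CARD('a))"
proof -
  interpret comm_ring_hom h by fact
  show ?thesis
  proof (induction a)
    case 0
    then show ?case by (simp add: power_0_left)
  next
    case (pCons c a)
    have "h c ^ CARD('a) = h c"
      by (simp add: power_card_finite_field flip: hom_power)
    then have "(h c + x * poly (map_poly h a) x) ^ CARD('a) =
        h c + x ^ CARD('a) * poly (map_poly h a) (x ^ CARD('a))"
      by (simp only: power_card_add[OF assms] power_mult_distrib pCons.IH)
    then show ?case
      by (simp only: map_poly_pCons_hom poly_pCons)
  qed
qed

lemma poly_map_poly_power_card_power: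
  fixes h :: "'a::{field, finite} \<Rightarrow> 'b::comm_ring_1"
  assumes "comm_ring_hom h"
  shows "poly (map_poly h a) x ^ (CARD('a) ^ k) = poly (map_poly h a) (x ^ (CARD('a) ^ k))"
proof (induction k)
  case 0
  then show ?case by simp
next
  case (Suc k)
  let ?q = "CARD('a)"
  have "poly (map_poly h a) x ^ (?q ^ Suc k) = (poly (map_poly h a) x ^ (?q ^ k)) ^ ?q"
    by (simp only: power_Suc2 power_mult)
  also have "\<dots> = poly (map_poly h a) ((x ^ (?q ^ k)) ^ ?q)"
    by (simp only: Suc.IH poly_map_poly_power_card[OF assms])
  also have "(x ^ (?q ^ k)) ^ ?q = x ^ (?q ^ Suc k)"
    by (simp only: power_Suc2 power_mult)
  finally show ?case .
qed

section \<open>Taylor's formula for hyperderivatives\<close>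

text \<open>
  Expanding each \<open>x\<^sup>m = (y + (x - y))\<^sup>m\<close> binomially and collecting the terms with \<open>(x - y)\<^sup>n\<close> gives
  precisely the defining sum of the \<open>n\<close>-th hyperderivative at \<open>y\<close>.
\<close>

lemma taylor_hyperderiv:
  fixes h :: "'a::field \<Rightarrow> 'b::comm_ring_1"
  assumes "comm_ring_hom h" and "degree a \<le> i"
  shows "poly (map_poly h a) x = (\<Sum>n\<le>i. poly (map_poly h (hyperderiv n a)) y * (x - y) ^ n)"
proof -
  interpret comm_ring_hom h by fact
  interpret H: map_poly_comm_ring_hom h ..
  have "a = (\<Sum>m\<le>i. monom (coeff a m) m)"
    using poly_as_sum_of_monoms'[OF assms(2)] by simp
  then have "poly (map_poly h a) x = poly (map_poly h (\<Sum>m\<le>i. monom (coeff a m) m)) x"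
    by simp
  also have "\<dots> = (\<Sum>m\<le>i. h (coeff a m) * x ^ m)"
    by (simp add: H.hom_sum poly_sum poly_monom)
  also have "\<dots> = (\<Sum>m\<le>i. \<Sum>n\<le>i.
      h (coeff a m) * of_nat (m choose n) * y ^ (m - n) * (x - y) ^ n)"
  proof (intro sum.cong refl)
    fix m assume m: "m \<in> {..i}"
    have "x ^ m = ((x - y) + y) ^ m"
      by simp
    also have "\<dots> = (\<Sum>n\<le>m. of_nat (m choose n) * (x - y) ^ n * y ^ (m - n))"
      by (rule binomial_ring)
    also have "\<dots> = (\<Sum>n\<le>i. of_nat (m choose n) * (x - y) ^ n * y ^ (m - n))"
      using m by (intro sum.mono_neutral_left) (auto simp: binomial_eq_0)
    finally show "h (coeff a m) * x ^ m = (\<Sum>n\<le>i.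
        h (coeff a m) * of_nat (m choose n) * y ^ (m - n) * (x - y) ^ n)"
      by (simp add: sum_distrib_left mult_ac)
  qed
  also have "\<dots> = (\<Sum>n\<le>i. \<Sum>m\<le>i.
      h (coeff a m) * of_nat (m choose n) * y ^ (m - n) * (x - y) ^ n)"
    by (rule sum.swap)
  also have "\<dots> = (\<Sum>n\<le>i. poly (map_poly h (hyperderiv n a)) y * (x - y) ^ n)"
  proof (intro sum.cong refl)
    fix n
    have "hyperderiv n a = (\<Sum>m\<le>i. monom (coeff a m * of_nat (m choose n)) (m - n))"
      unfolding hyperderiv_def using assms(2)
      by (intro sum.mono_neutral_left) (auto simp: coeff_eq_0)
    then show "(\<Sum>m\<le>i. h (coeff a m) * of_nat (m choose n) * y ^ (m - n) * (x - y) ^ n) =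
        poly (map_poly h (hyperderiv n a)) y * (x - y) ^ n"
      by (simp add: H.hom_sum poly_sum poly_monom hom_mult hom_of_nat sum_distrib_right)
  qed
  finally show ?thesis .
qed

section \<open>Solving Vandermonde systems\<close>

text \<open>
  The system says \<open>V u = w\<close> for the Vandermonde matrix \<open>V\<close> at the nodes \<open>x\<close>; the distinctness of
  the nodes makes \<open>V\<close> invertible, and the claim is the \<open>j\<close>-th entry of \<open>u = V\<^sup>-\<^sup>1 w\<close>.
\<close>

lemma kappa_solves_vandermonde:
  fixes x u w :: "nat \<Rightarrow> 'b::field"
  assumes inj: "inj_on x {..i}"
    and system: "\<And>l. l \<le> i \<Longrightarrow> w l = (\<Sum>n\<le>i. u n * x l ^ n)"
    and "j \<le> i"
  shows "u j = (\<Sum>l = 0..i. kappa i j l x * w l)"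
proof -
  from mat_inverse_vandermonde[OF inj] obtain B where
    B: "mat_inverse (vandermonde i x) = Some B" "B \<in> carrier_mat (Suc i) (Suc i)"
      "B * vandermonde i x = 1\<^sub>m (Suc i)"
    by metis
  let ?V = "vandermonde i x" and ?u = "vec (Suc i) u" and ?w = "vec (Suc i) w"
  have V: "?V \<in> carrier_mat (Suc i) (Suc i)"
    by (simp add: vandermonde_def)
  have "?V *\<^sub>v ?u = ?w"
    by (intro eq_vecI)
      (auto simp: vandermonde_def scalar_prod_def system mult.commute
        lessThan_Suc_atMost atLeast0LessThan)
  then have "B *\<^sub>v ?w = (B * ?V) *\<^sub>v ?u"
    using B(2) V by (simp add: assoc_mult_mat_vec)
  then have "?u = B *\<^sub>v ?w"
    using B(3) by simp
  then have "u j = (B *\<^sub>v ?w) $ j"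
    using \<open>j \<le> i\<close> by (metis index_vec less_Suc_eq_le)
  also have "\<dots> = (\<Sum>l = 0..i. B $$ (j, l) * w l)"
    using B(2) \<open>j \<le> i\<close>
    by (auto simp: scalar_prod_def atLeastLessThanSuc_atLeastAtMost intro!: sum.cong)
  finally show ?thesis
    by (simp add: kappa_def B(1))
qed

section \<open>The field of rational functions in two variables\<close>

text \<open>
  The inclusion of \<open>\<F>\<^sub>q\<close> into \<open>\<F>\<^sub>q(\<theta>, t)\<close>. Through it both \<open>a \<mapsto> a(\<theta>)\<close> and \<open>a \<mapsto> a(t)\<close> become
  evaluations of the same polynomial over \<open>\<F>\<^sub>q(\<theta>, t)\<close>, to which the results above apply.
\<close>

definition in_const :: "'a::field \<Rightarrow> 'a ratfun2" where
  "in_const c = to_fract [:[:c:]:]"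

lemma comm_ring_hom_in_const: "comm_ring_hom in_const"
  by unfold_locales (simp_all add: in_const_def one_pCons flip: to_fract_add to_fract_mult to_fract_1)

lemma in_theta_conv_poly: "in_theta a = poly (map_poly in_const a) theta"
proof -
  interpret comm_ring_hom in_const by (rule comm_ring_hom_in_const)
  show ?thesis
  proof (induction a)
    case 0
    then show ?case by (simp add: in_theta_def)
  next
    case (pCons c a)
    have "in_theta (pCons c a) = in_const c + theta * in_theta a"
      by (simp add: in_theta_def in_const_def theta_def flip: to_fract_add to_fract_mult)
    with pCons show ?case
      by (simp add: map_poly_pCons_hom)
  qed
qed

lemma in_t_conv_poly: "in_t a = poly (map_poly in_const a) tvar"
proof -
  interpret comm_ring_hom in_const by (rule comm_ring_hom_in_const)
  show ?thesis
  proof (induction a)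
    case 0
    then show ?case by (simp add: in_t_def)
  next
    case (pCons c a)
    have "in_t (pCons c a) = in_const c + tvar * in_t a"
      using pCons.hyps
      by (simp add: in_t_def in_const_def tvar_def map_poly_pCons flip: to_fract_add to_fract_mult)
    with pCons show ?case
      by (simp add: map_poly_pCons_hom)
  qed
qed

lemma tvar_power_eq_iff: "(tvar :: 'a::field ratfun2) ^ m = tvar ^ n \<longleftrightarrow> m = n"
proof -
  have power: "(tvar :: 'a ratfun2) ^ n = to_fract (monom 1 n)" for n
    by (induction n) (simp_all add: tvar_def monom_Suc flip: to_fract_mult)
  show ?thesis
    by (auto simp: power dest: arg_cong[where f = degree] simp: degree_monom_eq)
qed

section \<open>Hyperderivatives from Frobenius powers\<close>

theorem proposition4p6:
  fixes a :: "'a::{field, finite} poly" and i q :: nat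
  assumes "q = CARD('a)"
    and "degree a \<le> i"
  shows "(\<forall>j\<le>i. in_theta (hyperderiv j a) =
            (\<Sum>l = 0..i. kappa i j l (\<lambda>m. tvar ^ (q ^ m) - theta) * in_t a ^ (q ^ l))) \<and>
         (\<forall>j\<le>i. \<forall>k. in_theta (hyperderiv j a) ^ (q ^ k) =
            (\<Sum>l = 0..i. kappa i j l (\<lambda>m. tvar ^ (q ^ m) - theta ^ (q ^ k)) * in_t a ^ (q ^ l)))"
proof -
  (* The exponents q^m, and with them the nodes, are distinct only because q > 1. *)
  have "card {0, 1 :: 'a} \<le> q"
    unfolding assms(1) by (intro card_mono) auto
  then have q: "1 < q"
    by simp
  have frobenius: "poly (map_poly in_const b) x ^ (q ^ k) = poly (map_poly in_const b) (x ^ (q ^ k))"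
    for b :: "'a poly" and x k
    unfolding assms(1) by (rule poly_map_poly_power_card_power[OF comm_ring_hom_in_const])
  have general: "in_theta (hyperderiv j a) ^ (q ^ k) =
      (\<Sum>l = 0..i. kappa i j l (\<lambda>m. tvar ^ (q ^ m) - theta ^ (q ^ k)) * in_t a ^ (q ^ l))"
    if "j \<le> i" for j k
  proof (rule kappa_solves_vandermonde[OF _ _ that])
    show "inj_on (\<lambda>m. tvar ^ (q ^ m) - theta ^ (q ^ k) :: 'a ratfun2) {..i}"
      using q by (auto intro!: inj_onI simp: tvar_power_eq_iff)
    show "in_t a ^ (q ^ l) = (\<Sum>n\<le>i. in_theta (hyperderiv n a) ^ (q ^ k) *
        (tvar ^ (q ^ l) - theta ^ (q ^ k)) ^ n)" for l
      by (simp only: in_t_conv_poly in_theta_conv_poly frobenius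
          taylor_hyperderiv[OF comm_ring_hom_in_const assms(2), where y = "theta ^ (q ^ k)", symmetric])
  qed
  show ?thesis
    using general general[where k = 0] by simp
qed

end
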